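(* Let $k$ be a positive integer and let $T\in\mathbb{M}_k$ be a $k\times k$ complex matrix. Then for every positive integer $n$, $$\omega(T)=\frac{1}{n}\,\nu^n(T),\qquad\text{where}\quad \nu^n(T)=\sup\{|\mathrm{Tr}\,X| \;:\; X\in W^n(T)\}.$$
   Context: $\mathbb{M}_n=\mathbb{M}_n(\mathbb{C})$ is the algebra of $n\times n$ complex matrices with identity $I_n$; $\mathbb{M}_k$ is identified with the bounded linear operators on $\mathbb{C}^k$ with its standard inner product. $\mathrm{Tr}$ is the canonical (unnormalized) trace. The numerical radius of $T$ is $\omega(T)=\sup\{|\langle Tx,x\rangle| : \|x\|=1\}$. $C^*(T)$ denotes the unital $C^*$-algebra generated by $T$ (and the identity operator). A linear map $\Phi:\mathscr{A}\to\mathscr{B}$ between unital $C^*$-algebras is completely positive if for every $m\in\mathbb{N}$ the map $[A_{ij}]\mapsto[\Phi(A_{ij})]$ from $\mathbb{M}_m(\mathscr{A})$ to $\mathbb{M}_m(\mathscr{B})$ sends positive elements to positive elements. $CP_n(T)$ is the set of all unital completely positive linear maps $\Phi:C^*(T)\to\mathbb{M}_n$, and the $n$'th matricial range of $T$ is $W^n(T)=\{\Phi(T) : \Phi\in CP_n(T)\}\subseteq\mathbb{M}_n$. *)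

theory Defs
  imports "HOL-Analysis.Analysis"
begin

text \<open>
  Matrices of size \<open>k \<times> k\<close> are elements of \<^typ>\<open>complex^'k^'k\<close> with \<open>k = CARD('k)\<close>, acting
  on \<^typ>\<open>complex^'k\<close> by \<open>*v\<close>; the library norm on \<^typ>\<open>complex^'k\<close> is the Euclidean one.
\<close>

definition cinner :: "complex^'k \<Rightarrow> complex^'k \<Rightarrow> complex" where
  "cinner x y = (\<Sum>i\<in>UNIV. x $ i * cnj (y $ i))"

definition cscale :: "complex \<Rightarrow> complex^'k^'k \<Rightarrow> complex^'k^'k" where
  "cscale c A = (\<chi> i j. c * A $ i $ j)"

definition adj :: "complex^'k^'k \<Rightarrow> complex^'k^'k" where
  "adj A = (\<chi> i j. cnj (A $ j $ i))"

definition numerical_radius :: "complex^'k^'k \<Rightarrow> real" where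
  "numerical_radius T = (SUP x\<in>{x. norm x = 1}. cmod (cinner (T *v x) x))"

text \<open>
  The type's norm on matrices is the Frobenius norm; it induces the same topology as the
  operator norm, so \<^const>\<open>closed\<close> below is norm-closedness in the C*-sense.
\<close>

definition unital_cstar_subalgebra :: "(complex^'k^'k) set \<Rightarrow> bool" where
  "unital_cstar_subalgebra S \<longleftrightarrow>
     mat 1 \<in> S \<and>
     (\<forall>A\<in>S. \<forall>B\<in>S. A + B \<in> S) \<and>
     (\<forall>c. \<forall>A\<in>S. cscale c A \<in> S) \<and>
     (\<forall>A\<in>S. \<forall>B\<in>S. A ** B \<in> S) \<and>
     (\<forall>A\<in>S. adj A \<in> S) \<and>
     closed S"

definition cstar_generated :: "complex^'k^'k \<Rightarrow> (complex^'k^'k) set" where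
  "cstar_generated T = unital_cstar_subalgebra hull {T}"

text \<open>
  An \<open>m \<times> m\<close> matrix over \<open>k \<times> k\<close> matrices is a function on pairs of naturals, of which only the
  entries with \<open>i, j < m\<close> matter. It is positive if it is a positive operator on the
  \<open>m\<close>-fold direct sum of \<^typ>\<open>complex^'k\<close>.
\<close>

definition block_positive :: "nat \<Rightarrow> (nat \<Rightarrow> nat \<Rightarrow> complex^'k^'k) \<Rightarrow> bool" where
  "block_positive m A \<longleftrightarrow>
     (\<forall>x :: nat \<Rightarrow> complex^'k. (\<Sum>i<m. \<Sum>j<m. cinner (A i j *v x j) (x i)) \<in> \<real>\<^sub>\<ge>\<^sub>0)"

definition clinear_on :: "(complex^'k^'k) set \<Rightarrow> (complex^'k^'k \<Rightarrow> complex^'n^'n) \<Rightarrow> bool" where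
  "clinear_on S \<Phi> \<longleftrightarrow>
     (\<forall>A\<in>S. \<forall>B\<in>S. \<Phi> (A + B) = \<Phi> A + \<Phi> B) \<and>
     (\<forall>c. \<forall>A\<in>S. \<Phi> (cscale c A) = cscale c (\<Phi> A))"

definition completely_positive_on ::
    "(complex^'k^'k) set \<Rightarrow> (complex^'k^'k \<Rightarrow> complex^'n^'n) \<Rightarrow> bool" where
  "completely_positive_on S \<Phi> \<longleftrightarrow>
     (\<forall>m A. (\<forall>i<m. \<forall>j<m. A i j \<in> S) \<longrightarrow> block_positive m A \<longrightarrow>
        block_positive m (\<lambda>i j. \<Phi> (A i j)))"

text \<open>
  Maps on \<open>C*(T)\<close> are represented by total functions, constrained only on \<open>C*(T)\<close>.
\<close>

definition ucp_maps :: "complex^'k^'k \<Rightarrow> (complex^'k^'k \<Rightarrow> complex^'n^'n) set" where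
  "ucp_maps T = {\<Phi>. clinear_on (cstar_generated T) \<Phi> \<and>
     completely_positive_on (cstar_generated T) \<Phi> \<and> \<Phi> (mat 1) = mat 1}"

definition matricial_range :: "complex^'k^'k \<Rightarrow> (complex^'n^'n) set" where
  "matricial_range T = {\<Phi> T | \<Phi>. \<Phi> \<in> ucp_maps T}"

definition trace_radius :: "'n::finite itself \<Rightarrow> complex^'k^'k \<Rightarrow> real" where
  "trace_radius _ T = (SUP X\<in>(matricial_range T :: (complex^'n^'n) set). cmod (trace X))"

end

theory Submission
  imports Defs
begin

text \<open>
  Each unit vector \<open>x\<close> yields the unital completely positive map \<open>A \<mapsto> \<langle>Ax,x\<rangle> I\<close>, whose value at \<open>T\<close>
  has trace \<open>n \<langle>Tx,x\<rangle>\<close>; hence \<open>n \<omega>(T) \<le> \<nu>\<^sup>n(T)\<close>. Conversely, for \<open>\<Phi>\<close> unital completely positive,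
  \<open>Tr \<circ> \<Phi>\<close> is a positive functional with value \<open>n\<close> at the identity. For \<open>\<bar>c\<bar> = 1\<close> the matrix
  \<open>\<omega>(T) I - Re (c T)\<close> is positive, so \<open>Tr \<Phi>(Re (c T))\<close> is real and at most \<open>n \<omega>(T)\<close>. Choosing \<open>c\<close> with
  \<open>c Tr \<Phi>(T) = \<bar>Tr \<Phi>(T)\<bar>\<close> and decomposing \<open>c T = Re (c T) + \<i> Re (-\<i> c T)\<close> gives the other inequality.
\<close>

lemma cinner_add_left: "cinner (x + y) z = cinner x z + cinner y z"
  by (simp add: cinner_def distrib_right sum.distrib)

lemma cinner_diff_left: "cinner (x - y) z = cinner x z - cinner y z"
  by (simp add: cinner_def left_diff_distrib sum_subtractf)

lemma cinner_smult_left: "cinner (c *s x) y = c * cinner x y"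
  by (simp add: cinner_def sum_distrib_left mult.assoc)

lemma cinner_smult_right: "cinner x (c *s y) = cnj c * cinner x y"
  by (simp add: cinner_def sum_distrib_left algebra_simps)

lemma cinner_self: "cinner x x = of_real ((norm x)\<^sup>2)"
  by (simp add: cinner_def norm_vec_def L2_set_def sum_nonneg complex_norm_square del: of_real_power)

lemma cscale_mult_vec: "cscale c A *v x = c *s (A *v x)"
  by (simp add: cscale_def vec_eq_iff matrix_vector_mult_def sum_distrib_left mult.assoc)

lemma cinner_adj: "cinner (adj A *v x) y = cnj (cinner (A *v y) x)"
proof -
  have "cinner (adj A *v x) y = (\<Sum>i\<in>UNIV. \<Sum>j\<in>UNIV. cnj (A $ j $ i) * x $ j * cnj (y $ i))"
    by (simp add: cinner_def adj_def matrix_vector_mult_def sum_distrib_right)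
  also have "\<dots> = (\<Sum>j\<in>UNIV. \<Sum>i\<in>UNIV. cnj (A $ j $ i) * x $ j * cnj (y $ i))"
    by (rule sum.swap)
  also have "\<dots> = cnj (cinner (A *v y) x)"
    by (simp add: cinner_def matrix_vector_mult_def sum_distrib_left sum_distrib_right ac_simps)
  finally show ?thesis .
qed

text \<open>A continuous image of the compact unit sphere is bounded. This makes the supremum in
  \<open>numerical_radius\<close> a genuine upper bound.\<close>

lemma bdd_above_numerical_range:
  "bdd_above ((\<lambda>x. cmod (cinner (T *v x) x)) ` {x. norm x = 1})"
proof -
  have "continuous_on (sphere 0 1) (\<lambda>x. cmod (cinner (T *v x) x))"
    unfolding cinner_def matrix_vector_mult_def by (simp, intro continuous_intros)
  then have "compact ((\<lambda>x. cmod (cinner (T *v x) x)) ` sphere 0 1)"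
    using compact_sphere by (rule compact_continuous_image)
  moreover have "sphere 0 1 = {x. norm x = 1}"
    by auto
  ultimately show ?thesis
    by (metis bounded_imp_bdd_above compact_imp_bounded)
qed

text \<open>Both sides are homogeneous of degree 2 in \<open>x\<close>, so normalizing
  \<open>x\<close> reduces the claim to the definition of the supremum.\<close>

lemma cmod_cinner_le_numerical_radius:
  "cmod (cinner (T *v x) x) \<le> numerical_radius T * (norm x)\<^sup>2"
proof (cases "x = 0")
  case True
  then show ?thesis by (simp add: cinner_def)
next
  case False
  define u where "u = (1 / norm x) *\<^sub>R x"
  have u: "norm u = 1" using False by (simp add: u_def)
  have x: "x = of_real (norm x) *s u"
    using False by (simp add: u_def vec_eq_iff) (simp add: scaleR_conv_of_real)
  have "cinner (T *v x) x = of_real ((norm x)\<^sup>2) * cinner (T *v u) u"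
    \<comment> \<open>\<open>x\<close> recurs on the right of its own equation, so only the two
      occurrences in the left inner product are rewritten.\<close>
    by (subst (1 2) x)
      (simp add: vector_scalar_commute cinner_smult_left cinner_smult_right power2_eq_square)
  then have "cmod (cinner (T *v x) x) = (norm x)\<^sup>2 * cmod (cinner (T *v u) u)"
    by (simp add: norm_mult norm_power)
  moreover have "cmod (cinner (T *v u) u) \<le> numerical_radius T"
    unfolding numerical_radius_def using u
    by (intro cSUP_upper bdd_above_numerical_range) simp
  ultimately show ?thesis
    by (simp add: mult.commute[of "numerical_radius T"] mult_left_mono)
qed

text \<open>Each defining condition survives arbitrary intersections, so the hull satisfies them
  too.\<close>

lemma unital_cstar_subalgebra_generated: "unital_cstar_subalgebra (cstar_generated T)"
  unfolding cstar_generated_def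
proof (rule hull_in)
  fix \<A> :: "(complex^'a^'a) set set"
  assume "Ball \<A> unital_cstar_subalgebra"
  then show "unital_cstar_subalgebra (\<Inter>\<A>)"
    unfolding unital_cstar_subalgebra_def by (auto intro: closed_Inter)
qed

lemma in_cstar_generated: "T \<in> cstar_generated T"
  unfolding cstar_generated_def by (simp add: hull_inc)

definition re_part :: "complex^'k^'k \<Rightarrow> complex^'k^'k" where
  "re_part A = cscale (1/2) (A + adj A)"

text \<open>The form of the adjoint is the conjugate of the form of \<open>A\<close>, and
  \<open>re_part\<close> averages the two.\<close>

lemma cinner_re_part: "cinner (re_part A *v x) x = of_real (Re (cinner (A *v x) x))"
  by (simp add: re_part_def cscale_mult_vec matrix_vector_mult_add_rdistrib cinner_smult_left
      cinner_add_left cinner_adj)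
    (simp add: complex_eq_iff)

text \<open>The Cartesian decomposition, with the imaginary part written as a real part so that
  facts about \<open>re_part\<close> serve both summands.\<close>

lemma re_part_decomposition: "A = re_part A + cscale \<i> (re_part (cscale (-\<i>) A))"
  by (simp add: re_part_def cscale_def adj_def vec_eq_iff field_simps)

lemma trace_cscale: "trace (cscale c A) = c * trace A"
  by (simp add: trace_def cscale_def sum_distrib_left)

lemma sum_nonneg_Reals:
  assumes "\<And>i. i \<in> I \<Longrightarrow> f i \<in> (\<real>\<^sub>\<ge>\<^sub>0 :: complex set)"
  shows "sum f I \<in> \<real>\<^sub>\<ge>\<^sub>0"
  using assms by (induction I rule: infinite_finite_induct) auto

text \<open>The diagonal entries are the values of the form at the standard basis vectors.\<close>

lemma trace_nonneg:
  assumes "\<And>x. cinner (A *v x) x \<in> \<real>\<^sub>\<ge>\<^sub>0"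
  shows "trace A \<in> \<real>\<^sub>\<ge>\<^sub>0"
proof -
  have "cinner (A *v axis i 1) (axis i 1) = A $ i $ i" for i
    by (simp add: cinner_def matrix_vector_mult_def axis_def if_distrib cong: if_cong)
  then have "A $ i $ i \<in> \<real>\<^sub>\<ge>\<^sub>0" for i
    using assms by metis
  then show ?thesis
    unfolding trace_def by (intro sum_nonneg_Reals) auto
qed

lemma trace_ucp_nonneg:
  assumes "\<Phi> \<in> ucp_maps T" "A \<in> cstar_generated T" "\<And>x. cinner (A *v x) x \<in> \<real>\<^sub>\<ge>\<^sub>0"
  shows "trace (\<Phi> A) \<in> \<real>\<^sub>\<ge>\<^sub>0"
proof (rule trace_nonneg)
  fix x
  \<comment> \<open>Complete positivity is applied at level 1, where block positivity is positivity
    of \<open>A\<close> itself.\<close>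
  have "block_positive 1 (\<lambda>i j. A)"
    using assms(3) by (simp add: block_positive_def)
  then have "block_positive 1 (\<lambda>i j. \<Phi> A)"
    using assms(1,2) unfolding ucp_maps_def completely_positive_on_def by auto
  then show "cinner (\<Phi> A *v x) x \<in> \<real>\<^sub>\<ge>\<^sub>0"
    unfolding block_positive_def by (drule_tac spec[of _ "\<lambda>_. x"]) simp
qed

lemma trace_ucp_re_part:
  fixes \<Phi> :: "complex^'k^'k \<Rightarrow> complex^'n^'n"
  assumes \<Phi>: "\<Phi> \<in> ucp_maps T" and c: "cmod c = 1"
  shows "trace (\<Phi> (re_part (cscale c T))) \<in> \<real>"
    and "Re (trace (\<Phi> (re_part (cscale c T)))) \<le> real CARD('n) * numerical_radius T"
proof -
  let ?S = "cstar_generated T" and ?w = "of_real (numerical_radius T) :: complex"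
  define H where "H = re_part (cscale c T)"
  have alg: "unital_cstar_subalgebra ?S"
    by (rule unital_cstar_subalgebra_generated)
  have H: "H \<in> ?S"
    using alg in_cstar_generated[of T]
    by (simp add: H_def re_part_def unital_cstar_subalgebra_def)
  have one: "mat 1 \<in> ?S"
    using alg by (simp add: unital_cstar_subalgebra_def)
  \<comment> \<open>\<open>P\<close> is \<omega>(T) I - H. Subtraction is written as adding a
    multiple by -1 because the subalgebra and linearity conditions speak of sums and scalar
    multiples.\<close>
  define P where "P = cscale ?w (mat 1) + cscale (-1) H"
  have scaled: "cscale ?w (mat 1) \<in> ?S" "cscale (-1) H \<in> ?S"
    using alg one H by (simp_all add: unital_cstar_subalgebra_def)
  then have P: "P \<in> ?S"
    using alg by (simp add: P_def unital_cstar_subalgebra_def)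
  have "cinner (P *v x) x \<in> \<real>\<^sub>\<ge>\<^sub>0" for x
  proof -
    have "cinner (P *v x) x = of_real (numerical_radius T * (norm x)\<^sup>2 - Re (c * cinner (T *v x) x))"
      by (simp add: P_def H_def cscale_mult_vec matrix_vector_mult_add_rdistrib cinner_smult_left
          cinner_diff_left cinner_re_part cinner_self)
    moreover have "Re (c * cinner (T *v x) x) \<le> cmod (cinner (T *v x) x)"
      by (metis c complex_Re_le_cmod mult_1 norm_mult)
    then have "Re (c * cinner (T *v x) x) \<le> numerical_radius T * (norm x)\<^sup>2"
      using cmod_cinner_le_numerical_radius by (rule order_trans)
    ultimately show ?thesis
      by (simp only: nonneg_Reals_of_real_iff)
  qed
  then have pos: "trace (\<Phi> P) \<in> \<real>\<^sub>\<ge>\<^sub>0"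
    by (rule trace_ucp_nonneg[OF \<Phi> P])
  have "\<Phi> P = cscale ?w (mat 1) + cscale (-1) (\<Phi> H)"
    using \<Phi> scaled one H by (simp add: P_def ucp_maps_def clinear_on_def)
  then have "trace (\<Phi> P) = of_real (real CARD('n) * numerical_radius T) - trace (\<Phi> H)"
    by (simp add: trace_add trace_cscale trace_I)
  \<comment> \<open>A real number minus \<open>trace (\<Phi> H)\<close> is real and nonnegative,
    which yields both claims at once.\<close>
  with pos have "trace (\<Phi> H) \<in> \<real>" "Re (trace (\<Phi> H)) \<le> real CARD('n) * numerical_radius T"
    by (auto simp: complex_nonneg_Reals_iff complex_is_Real_iff)
  then show "trace (\<Phi> (re_part (cscale c T))) \<in> \<real>"
    and "Re (trace (\<Phi> (re_part (cscale c T)))) \<le> real CARD('n) * numerical_radius T"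
    by (simp_all add: H_def)
qed

lemma cmod_trace_ucp_le:
  fixes \<Phi> :: "complex^'k^'k \<Rightarrow> complex^'n^'n"
  assumes \<Phi>: "\<Phi> \<in> ucp_maps T"
  shows "cmod (trace (\<Phi> T)) \<le> real CARD('n) * numerical_radius T"
proof -
  let ?S = "cstar_generated T"
  obtain c where c: "cmod c = 1" "c * trace (\<Phi> T) = of_real (cmod (trace (\<Phi> T)))"
  proof (cases "trace (\<Phi> T) = 0")
    case True
    then show ?thesis using that[of 1] by simp
  next
    case False
    define z where "z = trace (\<Phi> T)"
    show ?thesis
    \<comment> \<open>The inverse phase of \<open>z\<close> rotates it onto the positive real
      axis.\<close>
    proof (rule that[of "cnj z / of_real (cmod z)"])
      show "cmod (cnj z / of_real (cmod z)) = 1"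
        using False by (simp add: z_def norm_divide)
      show "cnj z / of_real (cmod z) * trace (\<Phi> T) = of_real (cmod (trace (\<Phi> T)))"
        using False complex_norm_square[of z]
        by (simp add: z_def[symmetric] field_simps power2_eq_square)
    qed
  qed
  have alg: "unital_cstar_subalgebra ?S"
    by (rule unital_cstar_subalgebra_generated)
  \<comment> \<open>The real and imaginary parts of \<open>cscale c T\<close>. Since
    \<open>-\<i> * c\<close> also has modulus 1, \<open>trace_ucp_re_part\<close> covers
    \<open>K\<close> as well.\<close>
  define H K where "H = re_part (cscale c T)" and "K = re_part (cscale (-\<i> * c) T)"
  have HK: "H \<in> ?S" "K \<in> ?S"
    using alg in_cstar_generated[of T]
    by (simp_all add: H_def K_def re_part_def unital_cstar_subalgebra_def)
  have "cscale (-\<i>) (cscale c T) = cscale (-\<i> * c) T"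
    by (simp add: cscale_def vec_eq_iff mult.assoc)
  then have split: "cscale c T = H + cscale \<i> K"
    using re_part_decomposition[of "cscale c T"] by (simp add: H_def K_def)
  have iK: "cscale \<i> K \<in> ?S"
    using alg HK by (simp add: unital_cstar_subalgebra_def)
  have "cscale c (\<Phi> T) = \<Phi> (cscale c T)"
    using \<Phi> in_cstar_generated[of T] by (simp add: ucp_maps_def clinear_on_def)
  also have "\<dots> = \<Phi> H + cscale \<i> (\<Phi> K)"
    using \<Phi> HK iK by (simp add: split ucp_maps_def clinear_on_def)
  finally have "of_real (cmod (trace (\<Phi> T))) = trace (\<Phi> H) + \<i> * trace (\<Phi> K)"
    using c(2) by (metis trace_add trace_cscale)
  from arg_cong[OF this, of Re] have "cmod (trace (\<Phi> T)) = Re (trace (\<Phi> H)) - Im (trace (\<Phi> K))"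
    by simp
  \<comment> \<open>Reality of this trace removes the contribution of \<open>K\<close>, leaving the
    bound for \<open>H\<close> alone.\<close>
  moreover have "Im (trace (\<Phi> K)) = 0"
    using trace_ucp_re_part(1)[OF \<Phi>, of "-\<i> * c"] c(1)
    by (simp add: K_def complex_is_Real_iff norm_mult)
  ultimately show ?thesis
    using trace_ucp_re_part(2)[OF \<Phi> c(1)] by (simp add: H_def)
qed

text \<open>Complete positivity holds because the block form at \<open>y\<close> splits over the
  coordinates \<open>a\<close> of the target space. Each summand is the block form of
  \<open>A\<close> at the vectors \<open>y i $ a *s x\<close>.\<close>

lemma vector_state_ucp:
  fixes T :: "complex^'k^'k"
  assumes "norm x = 1"
  shows "(\<lambda>A. cscale (cinner (A *v x) x) (mat 1 :: complex^'n^'n)) \<in> ucp_maps T"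
proof -
  have "block_positive m (\<lambda>i j. cscale (cinner (A i j *v x) x) (mat 1 :: complex^'n^'n))"
    if A: "block_positive m A" for m A
    unfolding block_positive_def
  proof
    fix y :: "nat \<Rightarrow> complex^'n"
    have "(\<Sum>i<m. \<Sum>j<m. cinner (cscale (cinner (A i j *v x) x) (mat 1) *v y j) (y i))
        = (\<Sum>i<m. \<Sum>j<m. \<Sum>a\<in>UNIV. cinner (A i j *v (y j $ a *s x)) (y i $ a *s x))"
      by (simp add: cscale_mult_vec vector_scalar_commute cinner_smult_left cinner_smult_right
          cinner_def[of "y _"] sum_distrib_left algebra_simps)
    also have "\<dots> = (\<Sum>i<m. \<Sum>a\<in>UNIV. \<Sum>j<m. cinner (A i j *v (y j $ a *s x)) (y i $ a *s x))"
      by (intro sum.cong refl) (rule sum.swap)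
    also have "\<dots> = (\<Sum>a\<in>UNIV. \<Sum>i<m. \<Sum>j<m. cinner (A i j *v (y j $ a *s x)) (y i $ a *s x))"
      by (rule sum.swap)
    also have "\<dots> \<in> \<real>\<^sub>\<ge>\<^sub>0"
    proof (rule sum_nonneg_Reals)
      fix a
      show "(\<Sum>i<m. \<Sum>j<m. cinner (A i j *v (y j $ a *s x)) (y i $ a *s x)) \<in> \<real>\<^sub>\<ge>\<^sub>0"
        using A[unfolded block_positive_def] by (rule spec[of _ "\<lambda>i. y i $ a *s x"])
    qed
    finally show "(\<Sum>i<m. \<Sum>j<m. cinner (cscale (cinner (A i j *v x) x) (mat 1) *v y j) (y i)) \<in> \<real>\<^sub>\<ge>\<^sub>0" .
  qed
  then show ?thesis
    \<comment> \<open>The unit norm of \<open>x\<close> gives unitality.\<close>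
    using assms
    by (auto simp: ucp_maps_def clinear_on_def completely_positive_on_def cinner_self
        matrix_vector_mult_add_rdistrib cinner_add_left cscale_mult_vec cinner_smult_left)
      (auto simp: cscale_def vec_eq_iff algebra_simps)
qed

theorem theorem3p4:
  fixes T :: "complex^'k^'k"
  shows "numerical_radius T = 1 / real CARD('n::finite) * trace_radius TYPE('n) T"
proof -
  let ?R = "matricial_range T :: (complex^'n^'n) set"
  \<comment> \<open>This bound serves twice: for the upper estimate, and as the boundedness needed
    to compare single elements with \<open>trace_radius\<close>.\<close>
  have le: "cmod (trace X) \<le> real CARD('n) * numerical_radius T" if "X \<in> ?R" for X
    using that cmod_trace_ucp_le unfolding matricial_range_def by blast
  have in_range: "cscale (cinner (T *v x) x) (mat 1) \<in> ?R" if "norm x = 1" for x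
    using vector_state_ucp[OF that, of T] unfolding matricial_range_def by (intro CollectI exI conjI) auto
  \<comment> \<open>A unit vector shows that both suprema range over nonempty sets, as
    \<open>cSUP_least\<close> requires.\<close>
  obtain u :: "complex^'k" where u: "norm u = 1"
    using vector_choose_size zero_le_one by blast
  have "trace_radius TYPE('n) T \<le> real CARD('n) * numerical_radius T"
    unfolding trace_radius_def using in_range[OF u] le by (intro cSUP_least) auto
  moreover have "numerical_radius T \<le> trace_radius TYPE('n) T / real CARD('n)"
    unfolding numerical_radius_def
  proof (rule cSUP_least)
    show "{x :: complex^'k. norm x = 1} \<noteq> {}"
      using u by blast
    fix x :: "complex^'k"
    assume "x \<in> {x. norm x = 1}"
    then have "cscale (cinner (T *v x) x) (mat 1) \<in> ?R"
      by (simp add: in_range)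
    then have "cmod (trace (cscale (cinner (T *v x) x) (mat 1 :: complex^'n^'n))) \<le> trace_radius TYPE('n) T"
      unfolding trace_radius_def using le by (intro cSUP_upper bdd_aboveI2) auto
    then show "cmod (cinner (T *v x) x) \<le> trace_radius TYPE('n) T / real CARD('n)"
      by (simp add: trace_cscale trace_I norm_mult field_simps)
  qed
  ultimately show ?thesis
    by (simp add: field_simps)
qed

end
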